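(* Let $\gamma>1$ and $\alpha\in\mathbb{R}$. Then $$Z\hat C(\Delta_T^2;B_\alpha)\cap C^{\gamma}(\Delta_T^2;B_\alpha)=\{0\}.$$
   Context: Fix $T>0$. $(B_\alpha)_{\alpha\in\mathbb{R}}$ is a Banach scale, i.e. a family of Banach spaces such that for $\alpha\le\beta$ the embedding $B_\beta\hookrightarrow B_\alpha$ is continuous. $S=(S_t)_{t\ge0}$ is an analytic (in particular strongly continuous) semigroup of bounded linear operators acting on this scale, with $S_0=\mathrm{Id}$; for every $\alpha\in\mathbb{R}$, $\varepsilon\in(0,1)$ there is $C_{\alpha,\varepsilon,T}>0$ with $\|S_tx\|_{B_{\alpha+\varepsilon}}\le C_{\alpha,\varepsilon,T}t^{-\varepsilon}\|x\|_{B_\alpha}$ and $\|(S_t-\mathrm{Id})x\|_{B_\alpha}\le C_{\alpha,\varepsilon,T}t^{\varepsilon}\|x\|_{B_{\alpha+\varepsilon}}$ for all $t\in(0,T]$. $\Delta_T^n:=\{(t_1,\dots,t_n)\in[0,T]^n: 0\le t_n\le\dots\le t_1\le T\}$; $C(\Delta_T^n;B_\alpha)$ is the space of continuous maps $\Delta_T^n\to B_\alpha$. For $h\in C(\Delta_T^2;B_\alpha)$, $(\hat\delta h)_{tus}:=h_{ts}-h_{tu}-S_{t-u}h_{us}$ for $0\le s\le u\le t\le T$, and $Z\hat C(\Delta_T^2;B_\alpha):=\{h\in C(\Delta_T^2;B_\alpha):\hat\delta h=0\}$. $C^\gamma(\Delta_T^2;B_\alpha)$ is the set of $g\in C(\Delta_T^2;B_\alpha)$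 with $\|g\|_{\gamma,\alpha}:=\sup_{0\le s<t\le T}\|g_{ts}\|_{B_\alpha}/|t-s|^\gamma<\infty$. *)

theory Defs
  imports "HOL-Analysis.Analysis"
begin

text \<open>
  A family of Banach spaces indexed by real numbers is modelled by linear subspaces \<open>B \<alpha>\<close> of one
  ambient real vector space, each with its own norm \<open>N \<alpha>\<close>, the embeddings of the scale being the
  inclusions. Nothing is assumed about \<open>N \<alpha>\<close> outside \<open>B \<alpha>\<close>. Complex Banach spaces are covered by
  restriction of scalars.
\<close>

definition normed_space_on :: "'v::real_vector set \<Rightarrow> ('v \<Rightarrow> real) \<Rightarrow> bool" where
  "normed_space_on X N \<longleftrightarrow>
     subspace X \<and>
     (\<forall>x\<in>X. 0 \<le> N x) \<and>
     (\<forall>x\<in>X. N x = 0 \<longleftrightarrow> x = 0) \<and>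
     (\<forall>x\<in>X. \<forall>y\<in>X. N (x + y) \<le> N x + N y) \<and>
     (\<forall>c. \<forall>x\<in>X. N (c *\<^sub>R x) = \<bar>c\<bar> * N x)"

text \<open>
  The distance is set to 0 off the carrier because \<^locale>\<open>Metric_space\<close> requires nonnegativity and
  symmetry on the whole type.
\<close>

definition norm_dist :: "'v::real_vector set \<Rightarrow> ('v \<Rightarrow> real) \<Rightarrow> 'v \<Rightarrow> 'v \<Rightarrow> real" where
  "norm_dist X N x y = (if x \<in> X \<and> y \<in> X then N (x - y) else 0)"

abbreviation norm_topology :: "'v::real_vector set \<Rightarrow> ('v \<Rightarrow> real) \<Rightarrow> 'v topology" where
  "norm_topology X N \<equiv> Metric_space.mtopology X (norm_dist X N)"

lemma Metric_space_norm_dist: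
  assumes "normed_space_on X N"
  shows "Metric_space X (norm_dist X N)"
proof
  have sub: "subspace X" and nn: "\<And>x. x \<in> X \<Longrightarrow> 0 \<le> N x"
    and z: "\<And>x. x \<in> X \<Longrightarrow> N x = 0 \<longleftrightarrow> x = 0"
    and tri: "\<And>x y. x \<in> X \<Longrightarrow> y \<in> X \<Longrightarrow> N (x + y) \<le> N x + N y"
    and hom: "\<And>c x. x \<in> X \<Longrightarrow> N (c *\<^sub>R x) = \<bar>c\<bar> * N x"
    using assms by (auto simp: normed_space_on_def)
  show "0 \<le> norm_dist X N x y" for x y
    using nn sub by (simp add: norm_dist_def subspace_diff)
  show "norm_dist X N x y = norm_dist X N y x" for x y
    using hom[of "x - y" "-1"] sub by (auto simp: norm_dist_def subspace_diff)
  show "norm_dist X N x y = 0 \<longleftrightarrow> x = y" if "x \<in> X" "y \<in> X" for x y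
    using z sub that by (auto simp: norm_dist_def subspace_diff)
  show "norm_dist X N x w \<le> norm_dist X N x y + norm_dist X N y w"
    if "x \<in> X" "y \<in> X" "w \<in> X" for x y w
    using tri[of "x - y" "y - w"] sub that by (simp add: norm_dist_def subspace_diff)
qed

definition banach_space_on :: "'v::real_vector set \<Rightarrow> ('v \<Rightarrow> real) \<Rightarrow> bool" where
  "banach_space_on X N \<longleftrightarrow>
     normed_space_on X N \<and> Metric_space.mcomplete X (norm_dist X N)"

definition banach_scale ::
  "(real \<Rightarrow> 'v::real_vector set) \<Rightarrow> (real \<Rightarrow> 'v \<Rightarrow> real) \<Rightarrow> bool" where
  "banach_scale B N \<longleftrightarrow>
     (\<forall>\<alpha>. banach_space_on (B \<alpha>) (N \<alpha>)) \<and>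
     (\<forall>\<alpha> \<beta>. \<alpha> \<le> \<beta> \<longrightarrow> B \<beta> \<subseteq> B \<alpha> \<and>
        continuous_map (norm_topology (B \<beta>) (N \<beta>)) (norm_topology (B \<alpha>) (N \<alpha>)) (\<lambda>x. x))"

definition bounded_linear_on ::
  "'v::real_vector set \<Rightarrow> ('v \<Rightarrow> real) \<Rightarrow> ('v \<Rightarrow> 'v) \<Rightarrow> bool" where
  "bounded_linear_on X N A \<longleftrightarrow>
     A \<in> X \<rightarrow> X \<and>
     (\<forall>x\<in>X. \<forall>y\<in>X. A (x + y) = A x + A y) \<and>
     (\<forall>c. \<forall>x\<in>X. A (c *\<^sub>R x) = c *\<^sub>R A x) \<and>
     (\<exists>K. \<forall>x\<in>X. N (A x) \<le> K * N x)"

definition strongly_continuous_semigroup_on ::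
  "'v::real_vector set \<Rightarrow> ('v \<Rightarrow> real) \<Rightarrow> (real \<Rightarrow> 'v \<Rightarrow> 'v) \<Rightarrow> bool" where
  "strongly_continuous_semigroup_on X N S \<longleftrightarrow>
     (\<forall>t\<ge>0. bounded_linear_on X N (S t)) \<and>
     (\<forall>x\<in>X. S 0 x = x) \<and>
     (\<forall>t\<ge>0. \<forall>s\<ge>0. \<forall>x\<in>X. S (t + s) x = S t (S s x)) \<and>
     (\<forall>x\<in>X. continuous_map (top_of_set {0..}) (norm_topology X N) (\<lambda>t. S t x))"

text \<open>
  Analyticity of a semigroup on a real Banach space refers to its complexification \<open>X \<times> X\<close>, where
  \<open>(x, y)\<close> stands for \<open>x + i y\<close>. The norm \<open>N x + N y\<close> is equivalent to the usual complexification
  norms, and only its topology and the boundedness of operators matter below.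
\<close>

definition cplx_scale :: "complex \<Rightarrow> 'v::real_vector \<times> 'v \<Rightarrow> 'v \<times> 'v" where
  "cplx_scale c p =
     (Re c *\<^sub>R fst p - Im c *\<^sub>R snd p, Re c *\<^sub>R snd p + Im c *\<^sub>R fst p)"

definition cplx_norm :: "('v \<Rightarrow> real) \<Rightarrow> 'v \<times> 'v \<Rightarrow> real" where
  "cplx_norm N p = N (fst p) + N (snd p)"

definition sector :: "real \<Rightarrow> complex set" where
  "sector \<theta> = {z. z \<noteq> 0 \<and> \<bar>Arg z\<bar> < \<theta>}"

text \<open>
  The extension \<open>E\<close> is a holomorphic semigroup of bounded complex-linear operators on a sector
  around the positive half-axis, strongly continuous at the origin. Holomorphy is stated in the
  strong sense, which is equivalent to holomorphy in operator norm.
\<close>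

definition analytic_semigroup_on ::
  "'v::real_vector set \<Rightarrow> ('v \<Rightarrow> real) \<Rightarrow> (real \<Rightarrow> 'v \<Rightarrow> 'v) \<Rightarrow> bool" where
  "analytic_semigroup_on X N S \<longleftrightarrow>
     strongly_continuous_semigroup_on X N S \<and>
     (\<exists>\<theta> E. 0 < \<theta> \<and> \<theta> \<le> pi / 2 \<and>
        (\<forall>t>0. \<forall>x\<in>X. \<forall>y\<in>X. E (complex_of_real t) (x, y) = (S t x, S t y)) \<and>
        (\<forall>z\<in>sector \<theta>. bounded_linear_on (X \<times> X) (cplx_norm N) (E z) \<and>
           (\<forall>c. \<forall>p\<in>X \<times> X. E z (cplx_scale c p) = cplx_scale c (E z p))) \<and>
        (\<forall>z\<in>sector \<theta>. \<forall>w\<in>sector \<theta>. \<forall>p\<in>X \<times> X. E (z + w) p = E z (E w p)) \<and>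
        (\<forall>z\<in>sector \<theta>. \<forall>p\<in>X \<times> X. \<exists>d\<in>X \<times> X.
           ((\<lambda>w. cplx_norm N (E w p - E z p - cplx_scale (w - z) d) / cmod (w - z))
              \<longlongrightarrow> 0) (at z)) \<and>
        (\<forall>p\<in>X \<times> X. ((\<lambda>z. cplx_norm N (E z p - p)) \<longlongrightarrow> 0) (at 0 within sector \<theta>)))"

definition smoothing_on_scale ::
  "real \<Rightarrow> (real \<Rightarrow> 'v::real_vector set) \<Rightarrow> (real \<Rightarrow> 'v \<Rightarrow> real) \<Rightarrow> (real \<Rightarrow> 'v \<Rightarrow> 'v) \<Rightarrow> bool"
  where
  "smoothing_on_scale T B N S \<longleftrightarrow>
     (\<forall>\<alpha>. \<forall>\<epsilon>\<in>{0<..<1}. \<exists>C>0. \<forall>t\<in>{0<..T}.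
        (\<forall>x\<in>B \<alpha>. S t x \<in> B (\<alpha> + \<epsilon>) \<and>
           N (\<alpha> + \<epsilon>) (S t x) \<le> C * t powr (- \<epsilon>) * N \<alpha> x) \<and>
        (\<forall>x\<in>B (\<alpha> + \<epsilon>). N \<alpha> (S t x - x) \<le> C * t powr \<epsilon> * N (\<alpha> + \<epsilon>) x))"

definition analytic_semigroup_on_scale ::
  "real \<Rightarrow> (real \<Rightarrow> 'v::real_vector set) \<Rightarrow> (real \<Rightarrow> 'v \<Rightarrow> real) \<Rightarrow> (real \<Rightarrow> 'v \<Rightarrow> 'v) \<Rightarrow> bool"
  where
  "analytic_semigroup_on_scale T B N S \<longleftrightarrow>
     (\<forall>\<alpha>. analytic_semigroup_on (B \<alpha>) (N \<alpha>) S) \<and> smoothing_on_scale T B N S"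

definition Delta2 :: "real \<Rightarrow> (real \<times> real) set" where
  "Delta2 T = {(t, s). 0 \<le> s \<and> s \<le> t \<and> t \<le> T}"

definition Delta3 :: "real \<Rightarrow> (real \<times> real \<times> real) set" where
  "Delta3 T = {(t, u, s). 0 \<le> s \<and> s \<le> u \<and> u \<le> t \<and> t \<le> T}"

text \<open>
  Maps on a simplex are extensional functions, so that equality of elements of the function
  spaces is equality on the simplex.
\<close>

definition C_Delta2 ::
  "real \<Rightarrow> 'v::real_vector set \<Rightarrow> ('v \<Rightarrow> real) \<Rightarrow> (real \<times> real \<Rightarrow> 'v) set" where
  "C_Delta2 T X N =
     {h \<in> Delta2 T \<rightarrow>\<^sub>E X. continuous_map (top_of_set (Delta2 T)) (norm_topology X N) h}"

definition delta_hat ::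
  "real \<Rightarrow> (real \<Rightarrow> 'v::real_vector \<Rightarrow> 'v) \<Rightarrow> (real \<times> real \<Rightarrow> 'v)
     \<Rightarrow> real \<times> real \<times> real \<Rightarrow> 'v" where
  "delta_hat T S h =
     (\<lambda>(t, u, s)\<in>Delta3 T. h (t, s) - h (t, u) - S (t - u) (h (u, s)))"

definition ZC_Delta2 ::
  "real \<Rightarrow> (real \<Rightarrow> 'v \<Rightarrow> 'v) \<Rightarrow> 'v::real_vector set \<Rightarrow> ('v \<Rightarrow> real)
     \<Rightarrow> (real \<times> real \<Rightarrow> 'v) set" where
  "ZC_Delta2 T S X N = {h \<in> C_Delta2 T X N. delta_hat T S h = (\<lambda>_\<in>Delta3 T. 0)}"

definition hoelder_norm ::
  "real \<Rightarrow> real \<Rightarrow> ('v \<Rightarrow> real) \<Rightarrow> (real \<times> real \<Rightarrow> 'v) \<Rightarrow> ereal" where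
  "hoelder_norm T \<gamma> N g =
     (SUP (t, s)\<in>{(t, s). 0 \<le> s \<and> s < t \<and> t \<le> T}. ereal (N (g (t, s)) / \<bar>t - s\<bar> powr \<gamma>))"

definition C_hoelder_Delta2 ::
  "real \<Rightarrow> real \<Rightarrow> 'v::real_vector set \<Rightarrow> ('v \<Rightarrow> real) \<Rightarrow> (real \<times> real \<Rightarrow> 'v) set" where
  "C_hoelder_Delta2 T \<gamma> X N = {g \<in> C_Delta2 T X N. hoelder_norm T \<gamma> N g < \<infinity>}"

end

theory Submission
  imports Defs
begin

text \<open>
  A cocycle \<open>h\<close> satisfies \<open>h (t, s) = h (t, u) + S (t - u) (h (u, s))\<close>. Cutting \<open>[s, t]\<close> into \<open>n\<close>
  pieces of length \<open>d = (t - s) / n\<close> therefore writes \<open>h (t, s)\<close> as a sum of \<open>n\<close> terms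
  \<open>S r (h (v + d, v))\<close> with \<open>r\<close> a multiple of \<open>d\<close>, and each \<open>h (v + d, v)\<close> has size at most
  \<open>K d\<^sup>\<gamma>\<close>.

  A bound for the operators \<open>S r\<close>, uniform in \<open>r\<close>, would follow from strong continuity and the
  uniform boundedness principle, but a weaker bound is enough and is elementary: the smoothing
  estimate composed with the bounded embedding of \<open>B (\<alpha> + \<epsilon>)\<close> into \<open>B \<alpha>\<close> gives operator norm at
  most \<open>D r\<^sup>-\<^sup>\<epsilon>\<close> on \<open>B \<alpha>\<close>
  (\<open>semigroup_norm_blowup\<close>). Since \<open>r\<close> is either \<open>0\<close> or at least \<open>d\<close>, every term is at most
  \<open>(1 + D d\<^sup>-\<^sup>\<epsilon>) K d\<^sup>\<gamma>\<close>, and the sum (\<open>cocycle_norm_le_on_grid\<close>) is at most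
  \<open>(t - s) K (d\<^bsup>\<gamma>-1\<^esup> + D d\<^bsup>\<gamma>-1-\<epsilon>\<^esup>)\<close>. For \<open>0 < \<epsilon> < \<gamma> - 1\<close> this tends to \<open>0\<close> as \<open>n\<close> grows,
  which is where \<open>\<gamma> > 1\<close> enters.
\<close>

lemma normed_space_onD:
  assumes "normed_space_on X N"
  shows "subspace X"
    and "x \<in> X \<Longrightarrow> 0 \<le> N x"
    and "x \<in> X \<Longrightarrow> N x = 0 \<longleftrightarrow> x = 0"
    and "x \<in> X \<Longrightarrow> y \<in> X \<Longrightarrow> N (x + y) \<le> N x + N y"
    and "x \<in> X \<Longrightarrow> N (c *\<^sub>R x) = \<bar>c\<bar> * N x"
  using assms by (auto simp: normed_space_on_def)

lemma continuous_homogeneous_imp_bounded: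
  assumes X: "normed_space_on X N" and Y: "normed_space_on Y M"
    and cont: "continuous_map (norm_topology X N) (norm_topology Y M) f"
    and hom: "\<And>c x. x \<in> X \<Longrightarrow> f (c *\<^sub>R x) = c *\<^sub>R f x"
  shows "\<exists>L\<ge>0. \<forall>x\<in>X. M (f x) \<le> L * N x"
proof -
  interpret X: Metric_space X "norm_dist X N" by (rule Metric_space_norm_dist[OF X])
  have X0: "0 \<in> X" and Y0: "0 \<in> Y"
    using normed_space_onD(1)[OF X] normed_space_onD(1)[OF Y] by (auto simp: subspace_0)
  have f0: "f 0 = 0" using hom[OF X0, of 0] by simp
  have eps_delta: "f ` X \<subseteq> Y \<and> (\<forall>a\<in>X. \<forall>\<epsilon>>0. \<exists>\<delta>>0. \<forall>x. x \<in> X \<and> norm_dist X N a x < \<delta>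
      \<longrightarrow> norm_dist Y M (f a) (f x) < \<epsilon>)"
    using cont unfolding X.metric_continuous_map[OF Metric_space_norm_dist[OF Y]] .
  have fY: "f x \<in> Y" if "x \<in> X" for x using eps_delta that by auto
  have dist0X: "norm_dist X N 0 x = N x" if "x \<in> X" for x
    using normed_space_onD(5)[OF X that, of "-1"] X0 that by (simp add: norm_dist_def)
  have dist0Y: "norm_dist Y M 0 y = M y" if "y \<in> Y" for y
    using normed_space_onD(5)[OF Y that, of "-1"] Y0 that by (simp add: norm_dist_def)
  obtain \<delta> where \<delta>: "\<delta> > 0" "\<And>x. x \<in> X \<Longrightarrow> N x < \<delta> \<Longrightarrow> M (f x) < 1"
    using bspec[OF conjunct2[OF eps_delta] X0, rule_format, of 1] f0 dist0X dist0Y fY by auto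
  \<comment> \<open>Every nonzero vector is rescaled to norm \<open>\<delta> / 2\<close>, inside the ball where \<open>M (f x) < 1\<close>.\<close>
  have "M (f x) \<le> (2 / \<delta>) * N x" if x: "x \<in> X" for x
  proof (cases "x = 0")
    case True
    have "M 0 = 0" "N 0 = 0" using normed_space_onD(3) X Y X0 Y0 by blast+
    then show ?thesis using True f0 by simp
  next
    case False
    then have pos: "N x > 0" using normed_space_onD(2,3)[OF X x] by linarith
    define c where "c = \<delta> / (2 * N x)"
    have c: "c > 0" using pos \<delta> by (simp add: c_def)
    have cx: "c *\<^sub>R x \<in> X" using x normed_space_onD(1)[OF X] by (simp add: subspace_scale)
    have "N (c *\<^sub>R x) < \<delta>"
      using normed_space_onD(5)[OF X x, of c] c pos \<delta> by (simp add: c_def)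
    then have "M (f (c *\<^sub>R x)) < 1" using \<delta>(2)[OF cx] by simp
    then have "c * M (f x) < 1"
      using normed_space_onD(5)[OF Y fY[OF x], of c] c hom[OF x] by simp
    then show ?thesis using pos \<delta> by (simp add: c_def field_simps)
  qed
  then show ?thesis using \<delta>(1) by (intro exI[of _ "2 / \<delta>"]) auto
qed

text \<open>
  The loss of \<open>r powr - \<epsilon>\<close> is the price for measuring the smoothed vector again in the norm of
  \<open>B \<alpha>\<close>; as \<open>\<epsilon>\<close> is arbitrarily small, it can be absorbed by any power of the mesh exceeding one.
\<close>

lemma semigroup_norm_blowup:
  assumes scale: "banach_scale B N" and smooth: "smoothing_on_scale T B N S"
    and \<epsilon>: "0 < \<epsilon>" "\<epsilon> < 1"
  obtains D where "D \<ge> 0"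
    and "\<And>r x. 0 < r \<Longrightarrow> r \<le> T \<Longrightarrow> x \<in> B \<alpha> \<Longrightarrow> N \<alpha> (S r x) \<le> D * r powr - \<epsilon> * N \<alpha> x"
proof -
  have ns: "normed_space_on (B \<beta>) (N \<beta>)" for \<beta>
    using scale by (auto simp: banach_scale_def banach_space_on_def)
  have "continuous_map (norm_topology (B (\<alpha> + \<epsilon>)) (N (\<alpha> + \<epsilon>))) (norm_topology (B \<alpha>) (N \<alpha>)) (\<lambda>x. x)"
    using scale \<epsilon> by (auto simp: banach_scale_def)
  from continuous_homogeneous_imp_bounded[OF ns ns this]
  obtain L where L: "L \<ge> 0" "\<And>x. x \<in> B (\<alpha> + \<epsilon>) \<Longrightarrow> N \<alpha> x \<le> L * N (\<alpha> + \<epsilon>) x"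
    by auto
  obtain C where C: "C > 0" "\<And>r x. r \<in> {0<..T} \<Longrightarrow> x \<in> B \<alpha> \<Longrightarrow>
      S r x \<in> B (\<alpha> + \<epsilon>) \<and> N (\<alpha> + \<epsilon>) (S r x) \<le> C * r powr - \<epsilon> * N \<alpha> x"
    using bspec[OF spec[OF smooth[unfolded smoothing_on_scale_def], of \<alpha>], of \<epsilon>] \<epsilon> by auto
  show ?thesis
  proof (rule that)
    show "L * C \<ge> 0" using L C by simp
    show "N \<alpha> (S r x) \<le> L * C * r powr - \<epsilon> * N \<alpha> x" if "0 < r" "r \<le> T" "x \<in> B \<alpha>" for r x
    proof -
      have S: "S r x \<in> B (\<alpha> + \<epsilon>)" "N (\<alpha> + \<epsilon>) (S r x) \<le> C * r powr - \<epsilon> * N \<alpha> x"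
        using C(2)[of r x] that by auto
      have "N \<alpha> (S r x) \<le> L * N (\<alpha> + \<epsilon>) (S r x)" by (rule L(2)[OF S(1)])
      also have "\<dots> \<le> L * (C * r powr - \<epsilon> * N \<alpha> x)" by (rule mult_left_mono[OF S(2) L(1)])
      finally show ?thesis by (simp add: mult.assoc)
    qed
  qed
qed

text \<open>
  The right end point \<open>t\<close> stays fixed and pieces are split off at the left end. In this order the
  operators hitting the small increments are single operators \<open>S (k * d)\<close>, so their bound \<open>A\<close>
  enters once per term; splitting off at the right end would apply \<open>S d\<close> repeatedly and multiply
  its bounds.
\<close>

lemma cocycle_norm_le_on_grid:
  assumes X: "normed_space_on X N"
    and SX: "\<And>r x. 0 \<le> r \<Longrightarrow> x \<in> X \<Longrightarrow> S r x \<in> X"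
    and hX: "\<And>t s. 0 \<le> s \<Longrightarrow> s \<le> t \<Longrightarrow> t \<le> T \<Longrightarrow> h (t, s) \<in> X"
    and cocycle: "\<And>t u s. 0 \<le> s \<Longrightarrow> s \<le> u \<Longrightarrow> u \<le> t \<Longrightarrow> t \<le> T \<Longrightarrow>
      h (t, s) = h (t, u) + S (t - u) (h (u, s))"
    and diag: "\<And>t. 0 \<le> t \<Longrightarrow> t \<le> T \<Longrightarrow> h (t, t) = 0"
    and d: "0 \<le> d" and t: "t \<le> T"
    and A: "0 \<le> A" "\<And>k x. real k * d \<le> T \<Longrightarrow> x \<in> X \<Longrightarrow> N (S (real k * d) x) \<le> A * N x"
    and small: "\<And>v. 0 \<le> v \<Longrightarrow> v + d \<le> T \<Longrightarrow> N (h (v + d, v)) \<le> b"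
  shows "real n * d \<le> t \<Longrightarrow> N (h (t, t - real n * d)) \<le> real n * (A * b)"
proof (induction n)
  case 0
  have "N 0 = 0" using normed_space_onD(1,3)[OF X] subspace_0 by blast
  then show ?case using diag[of t] 0 t by simp
next
  case (Suc n)
  define u where "u = t - real n * d"
  define s where "s = t - real (Suc n) * d"
  have us: "u = s + d" and tu: "t - u = real n * d" by (simp_all add: u_def s_def algebra_simps)
  have nd: "0 \<le> real n * d" using d by simp
  have ord: "0 \<le> s" "s \<le> u" "u \<le> t" using Suc.prems d nd by (auto simp: u_def s_def algebra_simps)
  have hus: "h (u, s) \<in> X" using hX ord t by auto
  have "N (h (t, s)) \<le> N (h (t, u)) + N (S (t - u) (h (u, s)))"
    using cocycle[of s u t] ord t normed_space_onD(4)[OF X] hX[of u t] SX[of "t - u"] hus by simp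
  also have "N (h (t, u)) \<le> real n * (A * b)"
    using Suc.IH Suc.prems d by (simp add: u_def algebra_simps)
  also have "N (S (t - u) (h (u, s))) \<le> A * N (h (u, s))"
    unfolding tu using A(2)[of n] hus tu ord t by simp
  also have "A * N (h (u, s)) \<le> A * b"
    using small[of s] ord t us by (intro mult_left_mono A(1)) auto
  finally show ?case by (simp add: s_def algebra_simps)
qed

lemma hoelder_norm_finite_imp_bound:
  assumes "hoelder_norm T \<gamma> N g < \<infinity>"
  obtains K where "\<And>t s. 0 \<le> s \<Longrightarrow> s < t \<Longrightarrow> t \<le> T \<Longrightarrow> N (g (t, s)) \<le> K * (t - s) powr \<gamma>"
proof -
  obtain n where n: "hoelder_norm T \<gamma> N g < ereal (real n)"
    using less_PInf_Ex_of_nat assms by auto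
  have "N (g (t, s)) \<le> real n * (t - s) powr \<gamma>" if "0 \<le> s" "s < t" "t \<le> T" for t s
  proof -
    have "ereal (N (g (t, s)) / \<bar>t - s\<bar> powr \<gamma>) \<le> hoelder_norm T \<gamma> N g"
      unfolding hoelder_norm_def using that by (intro SUP_upper2[of "(t, s)"]) auto
    then have "ereal (N (g (t, s)) / \<bar>t - s\<bar> powr \<gamma>) < ereal (real n)" using n by (rule le_less_trans)
    then show ?thesis using that by (simp add: pos_divide_less_eq)
  qed
  then show ?thesis by (rule that[of "real n"])
qed

lemma hoelder_cocycle_eq_zero:
  assumes scale: "banach_scale B N" and smooth: "smoothing_on_scale T B N S"
    and S0: "\<And>x. x \<in> B \<alpha> \<Longrightarrow> S 0 x = x"
    and SB: "\<And>r x. 0 \<le> r \<Longrightarrow> x \<in> B \<alpha> \<Longrightarrow> S r x \<in> B \<alpha>"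
    and hB: "\<And>t s. 0 \<le> s \<Longrightarrow> s \<le> t \<Longrightarrow> t \<le> T \<Longrightarrow> h (t, s) \<in> B \<alpha>"
    and cocycle: "\<And>t u s. 0 \<le> s \<Longrightarrow> s \<le> u \<Longrightarrow> u \<le> t \<Longrightarrow> t \<le> T \<Longrightarrow>
      h (t, s) = h (t, u) + S (t - u) (h (u, s))"
    and \<gamma>: "1 < \<gamma>"
    and hoelder: "\<And>t s. 0 \<le> s \<Longrightarrow> s < t \<Longrightarrow> t \<le> T \<Longrightarrow> N \<alpha> (h (t, s)) \<le> K * (t - s) powr \<gamma>"
    and st: "0 \<le> s" "s \<le> t" "t \<le> T"
  shows "h (t, s) = 0"
proof -
  have ns: "normed_space_on (B \<alpha>) (N \<alpha>)"
    using scale by (auto simp: banach_scale_def banach_space_on_def)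
  note hBst = hB[OF st]
  have diag: "h (v, v) = 0" if "0 \<le> v" "v \<le> T" for v
    using cocycle[of v v v] S0 hB[of v v] that by simp
  show ?thesis
  proof (cases "s = t")
    case True
    then show ?thesis using diag st by simp
  next
    case False
    then have len: "0 < t - s" using st by simp
    \<comment> \<open>The smoothing estimate also needs \<open>\<epsilon> < 1\<close>, whence the minimum with \<open>2\<close>.\<close>
    define \<epsilon> where "\<epsilon> = (min \<gamma> 2 - 1) / 2"
    have \<epsilon>: "0 < \<epsilon>" "\<epsilon> < 1" "\<epsilon> < \<gamma> - 1" using \<gamma> by (auto simp: \<epsilon>_def min_def)
    obtain D where D: "D \<ge> 0"
      "\<And>r x. 0 < r \<Longrightarrow> r \<le> T \<Longrightarrow> x \<in> B \<alpha> \<Longrightarrow> N \<alpha> (S r x) \<le> D * r powr - \<epsilon> * N \<alpha> x"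
      by (rule semigroup_norm_blowup[OF scale smooth \<epsilon>(1,2), of \<alpha>]) (rule that)
    define d where "d n = (t - s) / real n" for n
    define bound where
      "bound n = (t - s) * K * (d n powr (\<gamma> - 1) + D * d n powr (\<gamma> - 1 - \<epsilon>))" for n
    have le: "N \<alpha> (h (t, s)) \<le> bound n" if n: "n > 0" for n
    proof -
      have d: "d n > 0" and nd: "real n * d n = t - s" using n len by (simp_all add: d_def)
      have pw: "d n powr \<gamma> = d n * d n powr (\<gamma> - 1)"
        "d n powr - \<epsilon> * d n powr (\<gamma> - 1) = d n powr (\<gamma> - 1 - \<epsilon>)"
        using powr_add[of "d n" 1 "\<gamma> - 1"] powr_add[of "d n" "- \<epsilon>" "\<gamma> - 1"] d
        by (simp_all add: add.commute)
      \<comment> \<open>The summand \<open>1\<close> accounts for \<open>k = 0\<close>, where the operator is the identity.\<close>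
      have op: "N \<alpha> (S (real k * d n) x) \<le> (1 + D * d n powr - \<epsilon>) * N \<alpha> x"
        if "real k * d n \<le> T" "x \<in> B \<alpha>" for k x
      proof (cases "k = 0")
        case True
        then show ?thesis
          using S0 that D normed_space_onD(2)[OF ns] by (simp add: algebra_simps)
      next
        case False
        then have r: "d n \<le> real k * d n" using d by simp
        have "N \<alpha> (S (real k * d n) x) \<le> D * (real k * d n) powr - \<epsilon> * N \<alpha> x"
          using D(2) that False d by simp
        also have "\<dots> \<le> (1 + D * d n powr - \<epsilon>) * N \<alpha> x"
        proof (rule mult_right_mono)
          have "(real k * d n) powr - \<epsilon> \<le> d n powr - \<epsilon>"
            using r d \<epsilon> by (intro powr_mono2') auto
          then have "D * (real k * d n) powr - \<epsilon> \<le> D * d n powr - \<epsilon>"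
            using D(1) by (rule mult_left_mono)
          then show "D * (real k * d n) powr - \<epsilon> \<le> 1 + D * d n powr - \<epsilon>" by simp
        qed (rule normed_space_onD(2)[OF ns that(2)])
        finally show ?thesis .
      qed
      have "N \<alpha> (h (t, t - real n * d n))
          \<le> real n * ((1 + D * d n powr - \<epsilon>) * (K * d n powr \<gamma>))"
      proof (rule cocycle_norm_le_on_grid[where S = S and h = h and T = T,
            OF ns SB hB cocycle diag _ _ _ op])
        show "N \<alpha> (h (v + d n, v)) \<le> K * d n powr \<gamma>" if "0 \<le> v" "v + d n \<le> T" for v
          using hoelder[of v "v + d n"] that d by simp
      qed (use d D st nd in auto)
      also have "\<dots> = (real n * d n) * K * (d n powr (\<gamma> - 1) +
          D * (d n powr - \<epsilon> * d n powr (\<gamma> - 1)))"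
        unfolding pw(1) by (simp add: algebra_simps)
      also have "\<dots> = bound n" unfolding nd pw(2) bound_def ..
      finally show ?thesis using nd by simp
    qed
    have d0: "d \<longlonglongrightarrow> 0"
      unfolding d_def by (rule lim_const_over_n)
    have pw0: "(\<lambda>n. d n powr a) \<longlonglongrightarrow> 0" if "a > 0" for a
      using tendsto_powr2[OF d0 tendsto_const[of a] _ that] len by (simp add: d_def)
    have "bound \<longlonglongrightarrow> (t - s) * K * (0 + D * 0)"
      unfolding bound_def using \<epsilon> \<gamma> by (intro tendsto_intros pw0) auto
    then have "N \<alpha> (h (t, s)) \<le> 0"
      using le by (intro tendsto_lowerbound[where f = bound and F = sequentially])
        (auto simp: eventually_sequentially intro!: exI[of _ 1])
    then show ?thesis using normed_space_onD(2,3)[OF ns hBst] by linarith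
  qed
qed

theorem proposition2p5:
  fixes T \<gamma> \<alpha> :: real
    and B :: "real \<Rightarrow> 'v::real_vector set"
    and N :: "real \<Rightarrow> 'v \<Rightarrow> real"
    and S :: "real \<Rightarrow> 'v \<Rightarrow> 'v"
  assumes "0 < T"
    and "banach_scale B N"
    and "analytic_semigroup_on_scale T B N S"
    and "1 < \<gamma>"
  shows "ZC_Delta2 T S (B \<alpha>) (N \<alpha>) \<inter> C_hoelder_Delta2 T \<gamma> (B \<alpha>) (N \<alpha>)
           = {\<lambda>_\<in>Delta2 T. 0}"
proof -
  have ns: "normed_space_on (B \<alpha>) (N \<alpha>)"
    using assms(2) by (auto simp: banach_scale_def banach_space_on_def)
  have smooth: "smoothing_on_scale T B N S"
    and sg: "strongly_continuous_semigroup_on (B \<alpha>) (N \<alpha>) S"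
    using assms(3) by (auto simp: analytic_semigroup_on_scale_def analytic_semigroup_on_def)
  have S0: "\<And>x. x \<in> B \<alpha> \<Longrightarrow> S 0 x = x"
    and bl: "\<And>r. 0 \<le> r \<Longrightarrow> bounded_linear_on (B \<alpha>) (N \<alpha>) (S r)"
    using sg by (auto simp: strongly_continuous_semigroup_on_def)
  have SB: "\<And>r x. 0 \<le> r \<Longrightarrow> x \<in> B \<alpha> \<Longrightarrow> S r x \<in> B \<alpha>"
    using bl unfolding bounded_linear_on_def by blast
  have B0: "0 \<in> B \<alpha>" using normed_space_onD(1)[OF ns] by (rule subspace_0)
  have Sz: "S r 0 = 0" if "0 \<le> r" for r
  proof -
    have "S r (0 *\<^sub>R 0) = 0 *\<^sub>R S r 0"
      using bl[OF that] B0 unfolding bounded_linear_on_def by blast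
    then show ?thesis by simp
  qed
  have N0: "N \<alpha> 0 = 0" using normed_space_onD(3)[OF ns B0] by simp
  show ?thesis
  proof (intro equalityI subsetI)
    fix h assume "h \<in> ZC_Delta2 T S (B \<alpha>) (N \<alpha>) \<inter> C_hoelder_Delta2 T \<gamma> (B \<alpha>) (N \<alpha>)"
    then have ext: "h \<in> Delta2 T \<rightarrow>\<^sub>E B \<alpha>" and dh: "delta_hat T S h = (\<lambda>_\<in>Delta3 T. 0)"
      and fin: "hoelder_norm T \<gamma> (N \<alpha>) h < \<infinity>"
      by (auto simp: ZC_Delta2_def C_Delta2_def C_hoelder_Delta2_def)
    obtain K where K: "\<And>t s. 0 \<le> s \<Longrightarrow> s < t \<Longrightarrow> t \<le> T \<Longrightarrow> N \<alpha> (h (t, s)) \<le> K * (t - s) powr \<gamma>"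
      by (rule hoelder_norm_finite_imp_bound[OF fin]) (rule that)
    have hB: "h (t, s) \<in> B \<alpha>" if "0 \<le> s" "s \<le> t" "t \<le> T" for t s
      using ext that by (auto simp: Delta2_def)
    have cocycle: "h (t, s) = h (t, u) + S (t - u) (h (u, s))"
      if "0 \<le> s" "s \<le> u" "u \<le> t" "t \<le> T" for t u s
      using fun_cong[OF dh, of "(t, u, s)"] that
      by (simp add: delta_hat_def Delta3_def algebra_simps)
    have "h (t, s) = 0" if "0 \<le> s" "s \<le> t" "t \<le> T" for t s
      by (rule hoelder_cocycle_eq_zero[where h = h and S = S and T = T,
            OF assms(2) smooth S0 SB hB cocycle assms(4) K that])
    then have "h = (\<lambda>_\<in>Delta2 T. 0)"
      using ext by (intro extensionalityI[where A = "Delta2 T"]) (auto simp: Delta2_def PiE_def)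
    then show "h \<in> {\<lambda>_\<in>Delta2 T. 0}" by simp
  next
    fix h :: "real \<times> real \<Rightarrow> 'v" assume "h \<in> {\<lambda>_\<in>Delta2 T. 0}"
    then have h: "h = (\<lambda>_\<in>Delta2 T. 0)" by simp
    interpret X: Metric_space "B \<alpha>" "norm_dist (B \<alpha>) (N \<alpha>)" by (rule Metric_space_norm_dist[OF ns])
    have "continuous_map (top_of_set (Delta2 T)) (norm_topology (B \<alpha>) (N \<alpha>)) (\<lambda>_. 0)"
      using B0 by simp
    then have "continuous_map (top_of_set (Delta2 T)) (norm_topology (B \<alpha>) (N \<alpha>)) h"
      by (rule continuous_map_eq) (simp add: h)
    then have C: "h \<in> C_Delta2 T (B \<alpha>) (N \<alpha>)"
      using B0 by (auto simp: C_Delta2_def h)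
    have "delta_hat T S h = (\<lambda>_\<in>Delta3 T. 0)"
      by (auto simp: delta_hat_def h fun_eq_iff restrict_def Delta2_def Delta3_def Sz)
    moreover have "hoelder_norm T \<gamma> (N \<alpha>) h \<le> 0"
      unfolding hoelder_norm_def by (rule SUP_least) (auto simp: h Delta2_def N0)
    ultimately show "h \<in> ZC_Delta2 T S (B \<alpha>) (N \<alpha>) \<inter> C_hoelder_Delta2 T \<gamma> (B \<alpha>) (N \<alpha>)"
      using C by (auto simp: ZC_Delta2_def C_hoelder_Delta2_def)
  qed
qed

end
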